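(* Let $R$ be a Noetherian, excellent, reduced, $F$-finite ring containing a field of characteristic $p>0$, and let $\mathfrak a\subseteq R$ be an ideal with $\mathfrak a\cap R^\circ\neq\emptyset$. Then $$\operatorname{fpt}(\mathfrak a)=\sup\{s\in\mathbb R_{\ge0}\mid \text{the pair }(R,\mathfrak a^s)\text{ is sharply }F\text{-pure}\}.$$
   Context: Rings are commutative with unit. $R^\circ$ is the set of elements of $R$ not contained in any minimal prime of $R$. Convention: $\mathfrak a^0=R$, and the definitions below are used also for exponent $s=0$. $R^{1/p^e}$ is the ring of $p^e$-th roots of elements of the reduced ring $R$, regarded as an $R$-module via $F^e:R\subseteq R^{1/p^e}$. For $f\in R$, $f^{1/p^e}F^e:R\to R^{1/p^e}$ is the $R$-linear map sending $1$ to $f^{1/p^e}$; it splits if it has an $R$-linear left inverse. $(R,\mathfrak a^s)$ is $F$-pure if for every $e\gg0$ there exists $f\in\mathfrak a^{\lfloor s(p^e-1)\rfloor}$ such that $f^{1/p^e}F^e$ splits. $(R,\mathfrak a^s)$ is strongly $F$-pure if there exists $e>0$ (equivalently, for all $e\gg0$) and $f\in\mathfrak a^{\lceil sp^e\rceil}$ such that $f^{1/p^e}F^e$ splits. $(R,\mathfrak a^s)$ is sharply $F$-pure if there exist infinitely many integers $e\ge0$ and associated elements $f_e\in\mathfrak a^{\lceil s(p^e-1)\rceil}$ such that each map $f_e^{1/p^e}F^e$ splits. The $F$-pure threshold is $\operatorname{fpt}(\mathfrak a)=\sup\{s\in\mathbb R_{\ge0}\mid (R,\mathfrak a^s)\text{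 is }F\text{-pure}\}=\sup\{s\in\mathbb R_{\ge0}\mid (R,\mathfrak a^s)\text{ is strongly }F\text{-pure}\}$ (equality of the two suprema is a known result of Takagi and Watanabe). Suprema are taken with the same convention (possibly $+\infty$) on both sides. *)

theory Defs
  imports "HOL-Algebra.Algebra" "HOL-Library.Extended_Real"
begin

section \<open>Elementary notions\<close>

definition reduced_ring :: "('a, 'm) ring_scheme \<Rightarrow> bool" where
  "reduced_ring R \<longleftrightarrow>
    (\<forall>x\<in>carrier R. \<forall>n::nat. x [^]\<^bsub>R\<^esub> n = \<zero>\<^bsub>R\<^esub> \<longrightarrow> x = \<zero>\<^bsub>R\<^esub>)"

definition has_char :: "('a, 'm) ring_scheme \<Rightarrow> nat \<Rightarrow> bool" where
  "has_char R p \<longleftrightarrow> (\<forall>n::nat. [n] \<cdot>\<^bsub>R\<^esub> \<one>\<^bsub>R\<^esub> = \<zero>\<^bsub>R\<^esub> \<longleftrightarrow> p dvd n)"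

definition contains_field_of_char :: "('a, 'm) ring_scheme \<Rightarrow> nat \<Rightarrow> bool" where
  "contains_field_of_char R p \<longleftrightarrow> (\<exists>K. subfield K R \<and> has_char (R\<lparr>carrier := K\<rparr>) p)"

definition minimal_prime :: "('a, 'm) ring_scheme \<Rightarrow> 'a set \<Rightarrow> bool" where
  "minimal_prime R P \<longleftrightarrow> primeideal P R \<and> (\<forall>Q. primeideal Q R \<longrightarrow> Q \<subseteq> P \<longrightarrow> Q = P)"

definition not_in_minimal_primes :: "('a, 'm) ring_scheme \<Rightarrow> 'a set" where
  "not_in_minimal_primes R = {x \<in> carrier R. \<forall>P. minimal_prime R P \<longrightarrow> x \<notin> P}"

abbreviation ideal_power :: "('a, 'm) ring_scheme \<Rightarrow> 'a set \<Rightarrow> nat \<Rightarrow> 'a set" where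
  "ideal_power R I n \<equiv> I [^]\<^bsub>ideals_set R\<^esub> n"

text \<open>The ring \<open>S\<close> as a module over another ring by restriction of scalars along \<open>h\<close>.\<close>

definition alg_module :: "('a \<Rightarrow> 'b) \<Rightarrow> ('b, 'm) ring_scheme \<Rightarrow> ('a, 'b) module" where
  "alg_module h S =
    \<lparr>carrier = carrier S, monoid.mult = monoid.mult S, one = one S,
     ring.zero = ring.zero S, ring.add = ring.add S, smult = (\<lambda>r x. h r \<otimes>\<^bsub>S\<^esub> x)\<rparr>"

definition fin_gen_module :: "('a, 'm) ring_scheme \<Rightarrow> ('a, 'b, 'n) module_scheme \<Rightarrow> bool" where
  "fin_gen_module R M \<longleftrightarrow>
    (\<exists>B \<subseteq> carrier M. finite B \<and>
      (\<forall>y\<in>carrier M. \<exists>c \<in> B \<rightarrow> carrier R. y = (\<Oplus>\<^bsub>M\<^esub>x\<in>B. c x \<odot>\<^bsub>M\<^esub> x)))"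

definition linear_map ::
  "('a, 'm) ring_scheme \<Rightarrow> ('a, 'b, 'n) module_scheme \<Rightarrow> ('a, 'c, 'k) module_scheme
    \<Rightarrow> ('b \<Rightarrow> 'c) \<Rightarrow> bool" where
  "linear_map R M N \<phi> \<longleftrightarrow>
    \<phi> \<in> carrier M \<rightarrow> carrier N \<and>
    (\<forall>x\<in>carrier M. \<forall>y\<in>carrier M. \<phi> (x \<oplus>\<^bsub>M\<^esub> y) = \<phi> x \<oplus>\<^bsub>N\<^esub> \<phi> y) \<and>
    (\<forall>r\<in>carrier R. \<forall>x\<in>carrier M. \<phi> (r \<odot>\<^bsub>M\<^esub> x) = r \<odot>\<^bsub>N\<^esub> \<phi> x)"

section \<open>Localization, completion and tensor products\<close>

definition frac_rel :: "('a, 'm) ring_scheme \<Rightarrow> 'a set \<Rightarrow> (('a \<times> 'a) \<times> ('a \<times> 'a)) set" where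
  "frac_rel R S =
    {((a, s), (b, t)) | a s b t. a \<in> carrier R \<and> s \<in> S \<and> b \<in> carrier R \<and> t \<in> S \<and>
      (\<exists>u\<in>S. u \<otimes>\<^bsub>R\<^esub> (a \<otimes>\<^bsub>R\<^esub> t) = u \<otimes>\<^bsub>R\<^esub> (b \<otimes>\<^bsub>R\<^esub> s))}"

definition fraction :: "('a, 'm) ring_scheme \<Rightarrow> 'a set \<Rightarrow> 'a \<Rightarrow> 'a \<Rightarrow> ('a \<times> 'a) set" where
  "fraction R S a s = frac_rel R S `` {(a, s)}"

definition localization :: "('a, 'm) ring_scheme \<Rightarrow> 'a set \<Rightarrow> ('a \<times> 'a) set ring" where
  "localization R S =
    \<lparr>carrier = (carrier R \<times> S) // frac_rel R S,
     monoid.mult = (\<lambda>U V. \<Union>(a, s)\<in>U. \<Union>(b, t)\<in>V. fraction R S (a \<otimes>\<^bsub>R\<^esub> b) (s \<otimes>\<^bsub>R\<^esub> t)),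
     one = fraction R S \<one>\<^bsub>R\<^esub> \<one>\<^bsub>R\<^esub>,
     ring.zero = fraction R S \<zero>\<^bsub>R\<^esub> \<one>\<^bsub>R\<^esub>,
     ring.add = (\<lambda>U V. \<Union>(a, s)\<in>U. \<Union>(b, t)\<in>V.
       fraction R S ((a \<otimes>\<^bsub>R\<^esub> t) \<oplus>\<^bsub>R\<^esub> (b \<otimes>\<^bsub>R\<^esub> s)) (s \<otimes>\<^bsub>R\<^esub> t))\<rparr>"

abbreviation local_at :: "('a, 'm) ring_scheme \<Rightarrow> 'a set \<Rightarrow> ('a \<times> 'a) set ring" where
  "local_at R P \<equiv> localization R (carrier R - P)"

definition local_ring :: "('a, 'm) ring_scheme \<Rightarrow> bool" where
  "local_ring A \<longleftrightarrow> cring A \<and> (\<exists>!m. maximalideal m A)"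

definition max_ideal :: "('a, 'm) ring_scheme \<Rightarrow> 'a set" where
  "max_ideal A = (THE m. maximalideal m A)"

definition residue_field_at :: "('a, 'm) ring_scheme \<Rightarrow> 'a set \<Rightarrow> ('a \<times> 'a) set set ring" where
  "residue_field_at R P = local_at R P Quot max_ideal (local_at R P)"

definition to_residue_field_at :: "('a, 'm) ring_scheme \<Rightarrow> 'a set \<Rightarrow> 'a \<Rightarrow> ('a \<times> 'a) set set" where
  "to_residue_field_at R P a =
    max_ideal (local_at R P) +>\<^bsub>local_at R P\<^esub> fraction R (carrier R - P) a \<one>\<^bsub>R\<^esub>"

text \<open>The adic completion is the inverse limit of the \<open>A/I\<^sup>n\<close>.  Its elements are sequences of cosets;
  the transition map \<open>A/I\<^sup>n\<^sup>+\<^sup>1 \<rightarrow> A/I\<^sup>n\<close> sends a coset to the unique coset containing it.\<close>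

definition completion :: "('a, 'm) ring_scheme \<Rightarrow> 'a set \<Rightarrow> (nat \<Rightarrow> 'a set) ring" where
  "completion A I =
    \<lparr>carrier = {x. \<forall>n. x n \<in> carrier (A Quot ideal_power A I n) \<and> x (Suc n) \<subseteq> x n},
     monoid.mult = (\<lambda>x y n. x n \<otimes>\<^bsub>A Quot ideal_power A I n\<^esub> y n),
     one = (\<lambda>n. \<one>\<^bsub>A Quot ideal_power A I n\<^esub>),
     ring.zero = (\<lambda>n. \<zero>\<^bsub>A Quot ideal_power A I n\<^esub>),
     ring.add = (\<lambda>x y n. x n \<oplus>\<^bsub>A Quot ideal_power A I n\<^esub> y n)\<rparr>"

definition to_completion :: "('a, 'm) ring_scheme \<Rightarrow> 'a set \<Rightarrow> 'a \<Rightarrow> nat \<Rightarrow> 'a set" where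
  "to_completion A I a = (\<lambda>n. ideal_power A I n +>\<^bsub>A\<^esub> a)"

text \<open>Tensor product \<open>C \<otimes>\<^sub>A D\<close> of two \<open>A\<close>-algebras with structure maps \<open>f\<close> and \<open>g\<close>: a list
  \<open>[(c\<^sub>1, d\<^sub>1), \<dots>, (c\<^sub>k, d\<^sub>k)]\<close> stands for \<open>c\<^sub>1 \<otimes> d\<^sub>1 + \<dots> + c\<^sub>k \<otimes> d\<^sub>k\<close>, and \<open>tensor_rel\<close> is
  the congruence generated by the tensor relations.  Formal negatives are not needed, since
  \<open>(- c) \<otimes> d\<close> is an additive inverse of \<open>c \<otimes> d\<close>.\<close>

inductive_set tensor_rel ::
  "('a, 'm) ring_scheme \<Rightarrow> ('c, 'n) ring_scheme \<Rightarrow> ('d, 'k) ring_scheme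
    \<Rightarrow> ('a \<Rightarrow> 'c) \<Rightarrow> ('a \<Rightarrow> 'd) \<Rightarrow> (('c \<times> 'd) list \<times> ('c \<times> 'd) list) set"
  for A C D f g
where
  refl: "set xs \<subseteq> carrier C \<times> carrier D \<Longrightarrow> (xs, xs) \<in> tensor_rel A C D f g"
| sym: "(xs, ys) \<in> tensor_rel A C D f g \<Longrightarrow> (ys, xs) \<in> tensor_rel A C D f g"
| trans: "(xs, ys) \<in> tensor_rel A C D f g \<Longrightarrow> (ys, zs) \<in> tensor_rel A C D f g
    \<Longrightarrow> (xs, zs) \<in> tensor_rel A C D f g"
| append: "(xs, xs') \<in> tensor_rel A C D f g \<Longrightarrow> (ys, ys') \<in> tensor_rel A C D f g
    \<Longrightarrow> (xs @ ys, xs' @ ys') \<in> tensor_rel A C D f g"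
| comm: "set xs \<subseteq> carrier C \<times> carrier D \<Longrightarrow> set ys \<subseteq> carrier C \<times> carrier D
    \<Longrightarrow> (xs @ ys, ys @ xs) \<in> tensor_rel A C D f g"
| zero: "d \<in> carrier D \<Longrightarrow> ([(\<zero>\<^bsub>C\<^esub>, d)], []) \<in> tensor_rel A C D f g"
| add_left: "c \<in> carrier C \<Longrightarrow> c' \<in> carrier C \<Longrightarrow> d \<in> carrier D
    \<Longrightarrow> ([(c \<oplus>\<^bsub>C\<^esub> c', d)], [(c, d), (c', d)]) \<in> tensor_rel A C D f g"
| add_right: "c \<in> carrier C \<Longrightarrow> d \<in> carrier D \<Longrightarrow> d' \<in> carrier D
    \<Longrightarrow> ([(c, d \<oplus>\<^bsub>D\<^esub> d')], [(c, d), (c, d')]) \<in> tensor_rel A C D f g"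
| balanced: "a \<in> carrier A \<Longrightarrow> c \<in> carrier C \<Longrightarrow> d \<in> carrier D
    \<Longrightarrow> ([(f a \<otimes>\<^bsub>C\<^esub> c, d)], [(c, g a \<otimes>\<^bsub>D\<^esub> d)]) \<in> tensor_rel A C D f g"

definition tensor_class ::
  "('a, 'm) ring_scheme \<Rightarrow> ('c, 'n) ring_scheme \<Rightarrow> ('d, 'k) ring_scheme
    \<Rightarrow> ('a \<Rightarrow> 'c) \<Rightarrow> ('a \<Rightarrow> 'd) \<Rightarrow> ('c \<times> 'd) list \<Rightarrow> ('c \<times> 'd) list set" where
  "tensor_class A C D f g xs = tensor_rel A C D f g `` {xs}"

definition tensor_ring ::
  "('a, 'm) ring_scheme \<Rightarrow> ('c, 'n) ring_scheme \<Rightarrow> ('d, 'k) ring_scheme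
    \<Rightarrow> ('a \<Rightarrow> 'c) \<Rightarrow> ('a \<Rightarrow> 'd) \<Rightarrow> ('c \<times> 'd) list set ring" where
  "tensor_ring A C D f g =
    \<lparr>carrier = {xs. set xs \<subseteq> carrier C \<times> carrier D} // tensor_rel A C D f g,
     monoid.mult = (\<lambda>U V. \<Union>xs\<in>U. \<Union>ys\<in>V.
       tensor_class A C D f g [(c \<otimes>\<^bsub>C\<^esub> c', d \<otimes>\<^bsub>D\<^esub> d'). (c, d) \<leftarrow> xs, (c', d') \<leftarrow> ys]),
     one = tensor_class A C D f g [(\<one>\<^bsub>C\<^esub>, \<one>\<^bsub>D\<^esub>)],
     ring.zero = tensor_class A C D f g [],
     ring.add = (\<lambda>U V. \<Union>xs\<in>U. \<Union>ys\<in>V. tensor_class A C D f g (xs @ ys))\<rparr>"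

section \<open>Excellent rings\<close>

text \<open>A chain \<open>P 0 \<subset> \<dots> \<subset> P n\<close> of primes of length \<open>n\<close>; only \<open>P 0, \<dots>, P n\<close> matter.\<close>

definition prime_chain :: "('a, 'm) ring_scheme \<Rightarrow> (nat \<Rightarrow> 'a set) \<Rightarrow> nat \<Rightarrow> bool" where
  "prime_chain R P n \<longleftrightarrow> (\<forall>i\<le>n. primeideal (P i) R) \<and> (\<forall>i<n. P i \<subset> P (Suc i))"

definition saturated_prime_chain :: "('a, 'm) ring_scheme \<Rightarrow> (nat \<Rightarrow> 'a set) \<Rightarrow> nat \<Rightarrow> bool" where
  "saturated_prime_chain R P n \<longleftrightarrow>
    prime_chain R P n \<and> (\<forall>i<n. \<not> (\<exists>Q. primeideal Q R \<and> P i \<subset> Q \<and> Q \<subset> P (Suc i)))"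

definition has_krull_dim :: "('a, 'm) ring_scheme \<Rightarrow> nat \<Rightarrow> bool" where
  "has_krull_dim R n \<longleftrightarrow> (\<exists>P. prime_chain R P n) \<and> (\<forall>P m. prime_chain R P m \<longrightarrow> m \<le> n)"

definition regular_local_ring :: "('a, 'm) ring_scheme \<Rightarrow> bool" where
  "regular_local_ring A \<longleftrightarrow>
    local_ring A \<and> noetherian_ring A \<and>
    (\<exists>B \<subseteq> carrier A. finite B \<and> max_ideal A = Idl\<^bsub>A\<^esub> B \<and> has_krull_dim A (card B))"

definition regular_ring :: "('a, 'm) ring_scheme \<Rightarrow> bool" where
  "regular_ring R \<longleftrightarrow>
    cring R \<and> noetherian_ring R \<and> (\<forall>P. primeideal P R \<longrightarrow> regular_local_ring (local_at R P))"

definition catenary :: "('a, 'm) ring_scheme \<Rightarrow> bool" where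
  "catenary R \<longleftrightarrow>
    (\<forall>P Q. primeideal P R \<longrightarrow> primeideal Q R \<longrightarrow> P \<subseteq> Q \<longrightarrow>
      (\<exists>n. (\<exists>C. saturated_prime_chain R C n \<and> C 0 = P \<and> C n = Q) \<and>
           (\<forall>C m. saturated_prime_chain R C m \<and> C 0 = P \<and> C m = Q \<longrightarrow> m = n)))"

definition fin_gen_algebra ::
  "('a, 'm) ring_scheme \<Rightarrow> ('a \<Rightarrow> 'b) \<Rightarrow> ('b, 'n) ring_scheme \<Rightarrow> bool" where
  "fin_gen_algebra R h S \<longleftrightarrow>
    cring S \<and> h \<in> ring_hom R S \<and>
    (\<exists>B \<subseteq> carrier S. finite B \<and> generate_ring S (h ` carrier R \<union> B) = carrier S)"

text \<open>The following definitions quantify over all finitely generated algebras, respectively all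
  finite field extensions, of a ring with elements of type \<open>'a\<close>.  Up to isomorphism, each of them
  has its carrier in \<open>'a list\<close>: its cardinality is at most that of \<open>'a\<close> or countable.\<close>

definition universally_catenary :: "('a, 'm) ring_scheme \<Rightarrow> bool" where
  "universally_catenary R \<longleftrightarrow>
    (\<forall>(S :: 'a list ring) h. fin_gen_algebra R h S \<longrightarrow> catenary S)"

text \<open>The closed subsets of \<open>Spec S\<close> are the sets of all primes containing a given ideal.\<close>

definition regular_locus_open :: "('a, 'm) ring_scheme \<Rightarrow> bool" where
  "regular_locus_open S \<longleftrightarrow>
    (\<exists>I. ideal I S \<and>
      (\<forall>P. primeideal P S \<longrightarrow> (regular_local_ring (local_at S P) \<longleftrightarrow> \<not> I \<subseteq> P)))"

definition J2_ring :: "('a, 'm) ring_scheme \<Rightarrow> bool" where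
  "J2_ring R \<longleftrightarrow>
    (\<forall>(S :: 'a list ring) h. fin_gen_algebra R h S \<longrightarrow> regular_locus_open S)"

definition finite_field_extension ::
  "('a, 'm) ring_scheme \<Rightarrow> ('a \<Rightarrow> 'b) \<Rightarrow> ('b, 'n) ring_scheme \<Rightarrow> bool" where
  "finite_field_extension K h L \<longleftrightarrow>
    field L \<and> h \<in> ring_hom K L \<and> fin_gen_module K (alg_module h L)"

definition geometrically_regular ::
  "('k, 'm) ring_scheme \<Rightarrow> ('k \<Rightarrow> 'b) \<Rightarrow> ('b, 'n) ring_scheme \<Rightarrow> bool" where
  "geometrically_regular K h B \<longleftrightarrow>
    (\<forall>(L :: 'k list ring) j. finite_field_extension K j L \<longrightarrow>
      regular_ring (tensor_ring K L B j h))"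

text \<open>The formal fibre of the local ring \<open>A\<close> over its prime \<open>Q\<close> is \<open>\<kappa>(Q) \<otimes>\<^sub>A C\<close> with \<open>C\<close> the completion of \<open>A\<close>,
  a \<open>\<kappa>(Q)\<close>-algebra via \<open>x \<mapsto> x \<otimes> 1\<close>.\<close>

definition formal_fibre_geometrically_regular :: "('a, 'm) ring_scheme \<Rightarrow> 'a set \<Rightarrow> bool" where
  "formal_fibre_geometrically_regular A Q \<longleftrightarrow>
    (let K = residue_field_at A Q;
         C = completion A (max_ideal A);
         f = to_residue_field_at A Q;
         g = to_completion A (max_ideal A)
     in geometrically_regular K (\<lambda>x. tensor_class A K C f g [(x, \<one>\<^bsub>C\<^esub>)]) (tensor_ring A K C f g))"

text \<open>The completion map of \<open>R\<^sub>P\<close> is flat for every Noetherian ring \<open>R\<close>, so that regularity of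
  this map is a condition on its fibres only.\<close>

definition G_ring :: "('a, 'm) ring_scheme \<Rightarrow> bool" where
  "G_ring R \<longleftrightarrow>
    noetherian_ring R \<and>
    (\<forall>P. primeideal P R \<longrightarrow>
      (\<forall>Q. primeideal Q (local_at R P) \<longrightarrow> formal_fibre_geometrically_regular (local_at R P) Q))"

definition excellent_ring :: "('a, 'm) ring_scheme \<Rightarrow> bool" where
  "excellent_ring R \<longleftrightarrow>
    cring R \<and> noetherian_ring R \<and> universally_catenary R \<and> G_ring R \<and> J2_ring R"

section \<open>Frobenius splittings and F-purity\<close>

text \<open>For a reduced ring \<open>R\<close> of characteristic \<open>p\<close>, taking \<open>p\<^sup>e\<close>-th roots is a ring isomorphism
  \<open>R \<rightarrow> R\<^bsup>1/p^e\<^esup>\<close>, and under it the inclusion \<open>R \<subseteq> R\<^bsup>1/p^e\<^esup>\<close> becomes \<open>F\<^sup>e\<close>.  Accordingly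
  \<open>x\<close> in the module \<open>root_module R p e\<close> stands for \<open>x\<^bsup>1/p^e\<^esup>\<close>, and the scalar product of \<open>r\<close>
  with it stands for \<open>r x\<^bsup>1/p^e\<^esup> = (r\<^bsup>p^e\<^esup> x)\<^bsup>1/p^e\<^esup>\<close>.\<close>

definition root_module :: "('a, 'm) ring_scheme \<Rightarrow> nat \<Rightarrow> nat \<Rightarrow> ('a, 'a) module" where
  "root_module R p e = alg_module (\<lambda>r. r [^]\<^bsub>R\<^esub> (p ^ e)) R"

definition F_finite :: "('a, 'm) ring_scheme \<Rightarrow> nat \<Rightarrow> bool" where
  "F_finite R p \<longleftrightarrow> fin_gen_module R (root_module R p 1)"

text \<open>The map \<open>f\<^bsup>1/p^e\<^esup> F\<^sup>e\<close> is the \<open>R\<close>-linear map sending \<open>1\<close> to \<open>f\<^bsup>1/p^e\<^esup>\<close>.\<close>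

definition root_map :: "('a, 'm) ring_scheme \<Rightarrow> nat \<Rightarrow> nat \<Rightarrow> 'a \<Rightarrow> 'a \<Rightarrow> 'a" where
  "root_map R p e f = (\<lambda>r. r \<odot>\<^bsub>root_module R p e\<^esub> f)"

definition root_map_splits :: "('a, 'm) ring_scheme \<Rightarrow> nat \<Rightarrow> nat \<Rightarrow> 'a \<Rightarrow> bool" where
  "root_map_splits R p e f \<longleftrightarrow>
    (\<exists>\<phi>. linear_map R (root_module R p e) (alg_module (\<lambda>r. r) R) \<phi> \<and>
      (\<forall>r\<in>carrier R. \<phi> (root_map R p e f r) = r))"

definition F_pure :: "('a, 'm) ring_scheme \<Rightarrow> nat \<Rightarrow> 'a set \<Rightarrow> real \<Rightarrow> bool" where
  "F_pure R p I s \<longleftrightarrow>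
    (\<forall>\<^sub>F e in sequentially.
      \<exists>f \<in> ideal_power R I (nat \<lfloor>s * (real p ^ e - 1)\<rfloor>). root_map_splits R p e f)"

definition sharply_F_pure :: "('a, 'm) ring_scheme \<Rightarrow> nat \<Rightarrow> 'a set \<Rightarrow> real \<Rightarrow> bool" where
  "sharply_F_pure R p I s \<longleftrightarrow>
    infinite {e. \<exists>f \<in> ideal_power R I (nat \<lceil>s * (real p ^ e - 1)\<rceil>). root_map_splits R p e f}"

text \<open>The supremum is taken in the extended reals, so that it is \<open>\<infinity>\<close> for an unbounded set and
  \<open>- \<infinity>\<close> for the empty set.\<close>

definition fpt :: "('a, 'm) ring_scheme \<Rightarrow> nat \<Rightarrow> 'a set \<Rightarrow> ereal" where
  "fpt R p I = (SUP s\<in>{s. 0 \<le> s \<and> F_pure R p I s}. ereal s)"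

end

theory Submission
  imports Defs
begin

text \<open>
  The two sets of exponents have the same supremum, since
  each of the two properties at exponent \<open>s\<close> implies the other at every exponent \<open>t\<close> with
  \<open>0 \<le> t < s\<close>, and also at \<open>t = 0\<close> if \<open>s = 0\<close>.

  From \<open>F\<close>-purity at \<open>s\<close> to sharp \<open>F\<close>-purity at \<open>t\<close>, this is because
  \<open>\<lceil>t (p\<^sup>e - 1)\<rceil> \<le> \<lfloor>s (p\<^sup>e - 1)\<rfloor>\<close> for all large \<open>e\<close>.

  For the converse, a splitting of \<open>f\<^bsup>1/p^e\<^esup> F\<^sup>e\<close> is the same as an additive map \<open>\<phi> : R \<rightarrow> R\<close> with
  \<open>\<phi> (r\<^bsup>p^e\<^esup> x) = r \<phi> x\<close> and \<open>\<phi> f = 1\<close>.  Composing such maps, splittings for \<open>(e, f)\<close> and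
  \<open>(e', g)\<close> give one for \<open>(e + e', f\<^bsup>p^e'\<^esup> g)\<close>.  Fix one \<open>d > 0\<close> and
  \<open>f \<in> \<aa>\<^bsup>\<lceil>s (q - 1)\<rceil>\<^esup>\<close>, \<open>q = p\<^sup>d\<close>, for which a splitting exists.  Its iterates split
  \<open>f\<^bsup>1 + q + \<dots> + q^(n-1)\<^esup>\<close> for the exponent \<open>n d\<close>, and this element lies in the power of \<open>\<aa>\<close> with exponent
  \<open>\<lceil>s (q - 1)\<rceil> (q\<^sup>n - 1) / (q - 1) \<ge> s (q\<^sup>n - 1)\<close>.  An arbitrary \<open>e\<close> is
  \<open>n d + r\<close> with \<open>r < d\<close>; sharp \<open>F\<close>-purity provides splittings for arbitrarily large exponents,
  and precomposing one of them with a power of the Frobenius and a multiplication splits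
  \<open>F\<^sup>r\<close> itself.  Thus one obtains a splitting for \<open>e\<close> and an element of \<open>\<aa>\<^sup>N\<close> with
  \<open>N \<ge> s (p\<^sup>e - p\<^sup>r)\<close>, which is at least \<open>t (p\<^sup>e - 1)\<close> for large \<open>e\<close>, as \<open>p\<^sup>r\<close> stays
  bounded by \<open>q\<close>.
\<close>

section \<open>The Frobenius endomorphism in prime characteristic\<close>

lemma (in cring) binomial_theorem:
  assumes x: "x \<in> carrier R" and y: "y \<in> carrier R"
  shows "(x \<oplus> y) [^] (n::nat) =
    (\<Oplus>k\<in>{..n}. [(n choose k)] \<cdot> (x [^] k \<otimes> y [^] (n - k)))"
proof (induction n)
  case 0
  then show ?case using x y by simp
next
  case (Suc n)
  define S where "S = (\<lambda>k. [(n choose k)] \<cdot> (x [^] k \<otimes> y [^] (n - k)))"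
  define U where "U = (\<lambda>k. [(n choose k)] \<cdot> (x [^] Suc k \<otimes> y [^] (n - k)))"
  define V where "V = (\<lambda>k. [(n choose k)] \<cdot> (x [^] k \<otimes> y [^] (Suc n - k)))"
  define T where "T = (\<lambda>k. [(Suc n choose k)] \<cdot> (x [^] k \<otimes> y [^] (Suc n - k)))"
  have cl [simp]: "S k \<in> carrier R" "U k \<in> carrier R" "V k \<in> carrier R" "T k \<in> carrier R" for k
    using x y by (auto simp: S_def U_def V_def T_def)
  have "S k \<otimes> x = U k" for k
  proof -
    have "S k \<otimes> x = [(n choose k)] \<cdot> (x [^] k \<otimes> y [^] (n - k) \<otimes> x)"
      unfolding S_def using x y by (simp add: add_pow_ldistr)
    also have "x [^] k \<otimes> y [^] (n - k) \<otimes> x = x [^] Suc k \<otimes> y [^] (n - k)"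
      using x y by (simp add: m_ac)
    finally show ?thesis by (simp add: U_def)
  qed
  then have Sx: "(\<Oplus>k\<in>{..n}. S k) \<otimes> x = (\<Oplus>k\<in>{..n}. U k)"
    using x by (simp add: finsum_ldistr)
  have "S k \<otimes> y = V k" if "k \<le> n" for k
  proof -
    have "S k \<otimes> y = [(n choose k)] \<cdot> (x [^] k \<otimes> y [^] (n - k) \<otimes> y)"
      unfolding S_def using x y by (simp add: add_pow_ldistr)
    also have "x [^] k \<otimes> y [^] (n - k) \<otimes> y = x [^] k \<otimes> y [^] (Suc n - k)"
      using x y that by (simp add: m_assoc Suc_diff_le)
    finally show ?thesis by (simp add: V_def)
  qed
  then have Sy: "(\<Oplus>k\<in>{..n}. S k) \<otimes> y = (\<Oplus>k\<in>{..n}. V k)"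
    using y by (simp add: finsum_ldistr cong: finsum_cong)
  have "T (Suc k) = U k \<oplus> V (Suc k)" for k
    unfolding T_def U_def V_def using x y by (simp add: add.nat_pow_mult [symmetric])
  moreover have T0: "T 0 = V 0"
    by (simp add: T_def V_def)
  ultimately have "(\<Oplus>k\<in>{..Suc n}. T k) = (\<Oplus>k\<in>{..n}. U k \<oplus> V (Suc k)) \<oplus> T 0"
    by (subst finsum_Suc2) auto
  also have "\<dots> = (\<Oplus>k\<in>{..n}. U k) \<oplus> ((\<Oplus>k\<in>{..n}. V (Suc k)) \<oplus> V 0)"
    by (simp add: finsum_addf a_assoc T0)
  also have "(\<Oplus>k\<in>{..n}. V (Suc k)) \<oplus> V 0 = (\<Oplus>k\<in>{..Suc n}. V k)"
    by (subst finsum_Suc2) auto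
  also have "\<dots> = V (Suc n) \<oplus> (\<Oplus>k\<in>{..n}. V k)"
    by (subst finsum_Suc) auto
  also have "V (Suc n) = \<zero>"
    by (simp add: V_def binomial_eq_0)
  finally have "(\<Oplus>k\<in>{..Suc n}. T k) = (\<Oplus>k\<in>{..n}. S k) \<otimes> (x \<oplus> y)"
    using x y by (simp add: r_distr Sx Sy)
  then show ?case
    using Suc by (simp add: T_def S_def)
qed

lemma has_char_imp_prime:
  assumes "domain S" and char: "has_char S p" and "p > 0"
  shows "Factorial_Ring.prime p"
proof -
  interpret S: domain S by fact
  have "p \<noteq> 1"
    using char[unfolded has_char_def, rule_format, of 1] by auto
  moreover have "a = 1 \<or> a = p" if "a dvd p" for a
  proof -
    obtain b where b: "p = a * b" using \<open>a dvd p\<close> by blast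
    have "[a] \<cdot>\<^bsub>S\<^esub> \<one>\<^bsub>S\<^esub> \<otimes>\<^bsub>S\<^esub> [b] \<cdot>\<^bsub>S\<^esub> \<one>\<^bsub>S\<^esub> = [p] \<cdot>\<^bsub>S\<^esub> \<one>\<^bsub>S\<^esub>"
      by (simp add: S.add_pow_ldistr S.add.nat_pow_pow b mult.commute)
    also have "\<dots> = \<zero>\<^bsub>S\<^esub>"
      using char by (simp add: has_char_def)
    finally have "[a] \<cdot>\<^bsub>S\<^esub> \<one>\<^bsub>S\<^esub> = \<zero>\<^bsub>S\<^esub> \<or> [b] \<cdot>\<^bsub>S\<^esub> \<one>\<^bsub>S\<^esub> = \<zero>\<^bsub>S\<^esub>"
      by (intro S.integral) auto
    then have "p dvd a \<or> p dvd b"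
      using char by (simp add: has_char_def)
    then show ?thesis
      using b \<open>p > 0\<close> by (auto dest!: dvd_imp_le)
  qed
  ultimately show ?thesis
    using \<open>p > 0\<close> by (auto simp: prime_nat_iff)
qed

lemma (in cring) contains_field_of_charD:
  assumes "contains_field_of_char R p" and "p > 0"
  shows "Factorial_Ring.prime p" and "has_char R p"
proof -
  obtain K where K: "subfield K R" and char: "has_char (R\<lparr>carrier := K\<rparr>) p"
    using assms(1) by (auto simp: contains_field_of_char_def)
  have "domain (R\<lparr>carrier := K\<rparr>)"
    using subfield_iff(2)[OF K] by (rule field.axioms)
  then show "Factorial_Ring.prime p"
    using char \<open>p > 0\<close> by (rule has_char_imp_prime)
  show "has_char R p"
    using char by (simp add: has_char_def add_pow_def nat_pow_def)
qed

lemma (in cring) frobenius_add: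
  assumes "Factorial_Ring.prime p" and char: "has_char R p"
    and x: "x \<in> carrier R" and y: "y \<in> carrier R"
  shows "(x \<oplus> y) [^] p = x [^] p \<oplus> y [^] p"
proof -
  define T where "T = (\<lambda>k. [(p choose k)] \<cdot> (x [^] k \<otimes> y [^] (p - k)))"
  have cl [simp]: "T k \<in> carrier R" for k
    using x y by (simp add: T_def)
  have T0: "T k = \<zero>" if "0 < k" "k < p" for k
  proof -
    have "p dvd p choose k"
      using \<open>Factorial_Ring.prime p\<close> that by (intro dvd_choose_prime) auto
    then have "[(p choose k)] \<cdot> \<one> = \<zero>"
      using char by (simp add: has_char_def)
    then have "[(p choose k)] \<cdot> (\<one> \<otimes> (x [^] k \<otimes> y [^] (p - k))) = \<zero>"
      using x y by (subst add_pow_ldistr [symmetric]) auto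
    then show ?thesis
      using x y by (simp add: T_def)
  qed
  obtain m where m: "p = Suc (Suc m)"
    using prime_ge_2_nat[OF \<open>Factorial_Ring.prime p\<close>] by (metis Suc_le_D numeral_2_eq_2 Suc_le_mono)
  have "(x \<oplus> y) [^] p = (\<Oplus>k\<in>{..Suc (Suc m)}. T k)"
    using binomial_theorem[OF x y, of p] by (simp add: T_def m)
  also have "\<dots> = T p \<oplus> (\<Oplus>k\<in>{..Suc m}. T k)"
    unfolding m by (rule finsum_Suc) auto
  also have "(\<Oplus>k\<in>{..Suc m}. T k) = (\<Oplus>k\<in>{..m}. T (Suc k)) \<oplus> T 0"
    by (rule finsum_Suc2) auto
  also have "(\<Oplus>k\<in>{..m}. T (Suc k)) = (\<Oplus>k\<in>{..m}. \<zero>)"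
    by (rule finsum_cong') (auto intro!: T0 simp: m)
  also have "T p = x [^] p"
    using x by (simp add: T_def)
  also have "T 0 = y [^] p"
    using y by (simp add: T_def)
  finally show ?thesis
    using x y by simp
qed

lemma (in cring) iterated_frobenius_add:
  assumes "Factorial_Ring.prime p" and "has_char R p" and "x \<in> carrier R" and "y \<in> carrier R"
  shows "(x \<oplus> y) [^] (p ^ d) = x [^] (p ^ d) \<oplus> y [^] (p ^ d)"
proof (induction d)
  case 0
  then show ?case using assms by simp
next
  case (Suc d)
  have "z [^] (p ^ Suc d) = (z [^] (p ^ d)) [^] p" if "z \<in> carrier R" for z
    using that by (simp add: nat_pow_pow mult.commute)
  then show ?case
    using Suc assms frobenius_add[OF assms(1,2)] by simp
qed

section \<open>Powers of an ideal\<close>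

lemma (in cring) monoid_ideals_set: "monoid (ideals_set R)"
  using ideals_set_is_semiring by (rule semiring.axioms)

lemma (in cring) ideal_power_is_ideal:
  assumes "ideal I R"
  shows "ideal (ideal_power R I n) R"
  using monoid.nat_pow_closed[OF monoid_ideals_set, of I n] assms by (simp add: ideals_set_def)

lemma (in cring) ideal_power_add:
  assumes "ideal I R"
  shows "ideal_power R I (m + n) = ideal_prod R (ideal_power R I m) (ideal_power R I n)"
  using monoid.nat_pow_mult[OF monoid_ideals_set, of I m n] assms by (simp add: ideals_set_def)

lemma (in cring) ideal_power_antimono:
  assumes "ideal I R" and "m \<le> n"
  shows "ideal_power R I n \<subseteq> ideal_power R I m"
proof -
  obtain k where "n = m + k"
    using \<open>m \<le> n\<close> le_Suc_ex by blast
  then show ?thesis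
    using ideal_prod_inter[OF ideal_power_is_ideal ideal_power_is_ideal, OF assms(1,1), of m k]
    by (simp add: ideal_power_add[OF assms(1)])
qed

lemma (in cring) mult_mem_ideal_power:
  assumes "ideal I R" and "x \<in> ideal_power R I m" and "y \<in> ideal_power R I n"
  shows "x \<otimes> y \<in> ideal_power R I (m + n)"
  using assms by (simp add: ideal_power_add ideal_prod.prod)

lemma (in cring) pow_mem_ideal_power:
  assumes "ideal I R" and "x \<in> ideal_power R I m"
  shows "x [^] (k::nat) \<in> ideal_power R I (m * k)"
proof (induction k)
  case 0
  then show ?case by (simp add: ideals_set_def)
next
  case (Suc k)
  then show ?case
    using mult_mem_ideal_power[OF assms(1) Suc assms(2)] by (simp add: add.commute)
qed

lemma (in cring) ideal_power_carrier:
  assumes "ideal I R" and "x \<in> ideal_power R I m"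
  shows "x \<in> carrier R"
  using ideal_power_is_ideal[OF assms(1)] assms(2) by (rule ideal.Icarr)

section \<open>Splittings as maps on the ring\<close>

text \<open>The \<open>p\<^bsup>-e\<^esup>\<close>-linear maps \<open>\<phi> : R \<rightarrow> R\<close>: these are the \<open>R\<close>-linear maps \<open>R\<^bsup>1/p^e\<^esup> \<rightarrow> R\<close>,
  an element of \<open>R\<^bsup>1/p^e\<^esup>\<close> being represented by its \<open>p\<^sup>e\<close>-th power.\<close>

definition cartier_map :: "('a, 'm) ring_scheme \<Rightarrow> nat \<Rightarrow> nat \<Rightarrow> ('a \<Rightarrow> 'a) \<Rightarrow> bool" where
  "cartier_map R p e \<phi> \<longleftrightarrow>
    \<phi> \<in> carrier R \<rightarrow> carrier R \<and>
    (\<forall>x\<in>carrier R. \<forall>y\<in>carrier R. \<phi> (x \<oplus>\<^bsub>R\<^esub> y) = \<phi> x \<oplus>\<^bsub>R\<^esub> \<phi> y) \<and>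
    (\<forall>r\<in>carrier R. \<forall>x\<in>carrier R. \<phi> (r [^]\<^bsub>R\<^esub> (p ^ e) \<otimes>\<^bsub>R\<^esub> x) = r \<otimes>\<^bsub>R\<^esub> \<phi> x)"

lemma (in cring) root_map_splits_iff:
  assumes "f \<in> carrier R"
  shows "root_map_splits R p e f \<longleftrightarrow> (\<exists>\<phi>. cartier_map R p e \<phi> \<and> \<phi> f = \<one>)"
proof -
  have "linear_map R (root_module R p e) (alg_module (\<lambda>r. r) R) \<phi> \<longleftrightarrow> cartier_map R p e \<phi>" for \<phi>
    by (simp add: linear_map_def root_module_def alg_module_def cartier_map_def)
  moreover have "(\<forall>r\<in>carrier R. \<phi> (root_map R p e f r) = r) \<longleftrightarrow> \<phi> f = \<one>"
    if "cartier_map R p e \<phi>" for \<phi>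
  proof -
    have *: "\<phi> (root_map R p e f r) = r \<otimes> \<phi> f" if "r \<in> carrier R" for r
      using \<open>cartier_map R p e \<phi>\<close> assms that
      by (simp add: cartier_map_def root_map_def root_module_def alg_module_def)
    have "\<phi> f \<in> carrier R"
      using that assms by (auto simp: cartier_map_def)
    then show ?thesis
      using * by (metis l_one one_closed r_one)
  qed
  ultimately show ?thesis
    unfolding root_map_splits_def by blast
qed

lemma (in cring) root_map_splits_comp:
  assumes f: "f \<in> carrier R" and g: "g \<in> carrier R"
    and "root_map_splits R p e f" and "root_map_splits R p e' g"
  shows "root_map_splits R p (e + e') (f [^] (p ^ e') \<otimes> g)"
proof -
  obtain \<phi> where \<phi>: "cartier_map R p e \<phi>" "\<phi> f = \<one>"
    using assms by (auto simp: root_map_splits_iff)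
  obtain \<psi> where \<psi>: "cartier_map R p e' \<psi>" "\<psi> g = \<one>"
    using assms by (auto simp: root_map_splits_iff)
  have pow: "r [^] (p ^ (e + e')) = (r [^] (p ^ e)) [^] (p ^ e')" if "r \<in> carrier R" for r
    using that by (simp add: nat_pow_pow power_add)
  have "cartier_map R p (e + e') (\<phi> \<circ> \<psi>)"
    using \<phi>(1) \<psi>(1) by (auto simp: cartier_map_def pow Pi_iff)
  moreover have "(\<phi> \<circ> \<psi>) (f [^] (p ^ e') \<otimes> g) = \<one>"
    using \<phi> \<psi> f g by (simp add: cartier_map_def)
  ultimately show ?thesis
    using f g by (auto simp: root_map_splits_iff)
qed

text \<open>If \<open>\<phi>\<close> splits \<open>f\<^bsup>1/p^(d+e)\<^esup> F\<^bsup>d+e\<^esup>\<close>, then \<open>x \<mapsto> \<phi> (f x\<^bsup>p^d\<^esup>)\<close> splits \<open>F\<^sup>e\<close>.\<close>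

lemma (in cring) root_map_splits_one:
  assumes "Factorial_Ring.prime p" and "has_char R p" and f: "f \<in> carrier R"
    and "root_map_splits R p (d + e) f"
  shows "root_map_splits R p e \<one>"
proof -
  obtain \<phi> where \<phi>: "cartier_map R p (d + e) \<phi>" "\<phi> f = \<one>"
    using assms by (auto simp: root_map_splits_iff)
  define \<psi> where "\<psi> = (\<lambda>x. \<phi> (f \<otimes> x [^] (p ^ d)))"
  have "\<psi> (r [^] (p ^ e) \<otimes> x) = r \<otimes> \<psi> x" if "r \<in> carrier R" "x \<in> carrier R" for r x
  proof -
    have "f \<otimes> (r [^] (p ^ e) \<otimes> x) [^] (p ^ d) = r [^] (p ^ (d + e)) \<otimes> (f \<otimes> x [^] (p ^ d))"
      using that f by (simp add: nat_pow_distrib nat_pow_pow power_add m_ac mult.commute)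
    then show ?thesis
      using \<phi>(1) that f by (simp add: \<psi>_def cartier_map_def)
  qed
  moreover have "\<psi> (x \<oplus> y) = \<psi> x \<oplus> \<psi> y" if "x \<in> carrier R" "y \<in> carrier R" for x y
    using \<phi>(1) that f
    by (simp add: \<psi>_def cartier_map_def iterated_frobenius_add[OF assms(1,2)] r_distr)
  moreover have "\<psi> \<in> carrier R \<rightarrow> carrier R"
    using \<phi>(1) f by (auto simp: \<psi>_def cartier_map_def)
  ultimately have "cartier_map R p e \<psi>"
    by (simp add: cartier_map_def)
  moreover have "\<psi> \<one> = \<one>"
    using \<phi>(2) f by (simp add: \<psi>_def)
  ultimately show ?thesis
    by (auto simp: root_map_splits_iff)
qed

text \<open>The witness is \<open>f\<^bsup>1 + q + \<dots> + q^(n-1)\<^esup>\<close> with \<open>q = p\<^sup>d\<close>.\<close>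

lemma (in cring) root_map_splits_iterate:
  assumes I: "ideal I R" and f: "f \<in> ideal_power R I N" and "root_map_splits R p d f"
    and one: "root_map_splits R p 0 \<one>"
  shows "\<exists>g \<in> ideal_power R I (N * (\<Sum>i<n. (p ^ d) ^ i)). root_map_splits R p (n * d) g"
proof (induction n)
  case 0
  then show ?case
    using one by (auto simp: ideals_set_def)
next
  case (Suc n)
  then obtain g where g: "g \<in> ideal_power R I (N * (\<Sum>i<n. (p ^ d) ^ i))"
      "root_map_splits R p (n * d) g"
    by blast
  have "f [^] (p ^ (n * d)) \<otimes> g \<in> ideal_power R I (N * p ^ (n * d) + N * (\<Sum>i<n. (p ^ d) ^ i))"
    by (intro mult_mem_ideal_power pow_mem_ideal_power I f g)
  also have "N * p ^ (n * d) + N * (\<Sum>i<n. (p ^ d) ^ i) = N * (\<Sum>i<Suc n. (p ^ d) ^ i)"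
    by (simp add: power_mult [symmetric] mult.commute algebra_simps)
  finally show ?case
    using root_map_splits_comp[OF _ _ assms(3) g(2)] ideal_power_carrier[OF I f]
      ideal_power_carrier[OF I g(1)] by auto
qed

section \<open>Comparison of the two notions of purity\<close>

lemma eventually_power_ge:
  fixes b c :: real
  assumes "1 < b"
  shows "\<forall>\<^sub>F e in sequentially. c \<le> b ^ e"
proof -
  obtain n where "c < b ^ n"
    using real_arch_pow[OF assms] by blast
  then have "c \<le> b ^ e" if "n \<le> e" for e
    using power_increasing[OF that, of b] assms by linarith
  then show ?thesis
    by (auto simp: eventually_sequentially)
qed

lemma (in cring) F_pure_imp_sharply_F_pure:
  assumes I: "ideal I R" and "p \<ge> 2" and pure: "F_pure R p I s"
    and "0 \<le> t" and t: "t < s \<or> t = 0"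
  shows "sharply_F_pure R p I t"
proof -
  have le: "\<forall>\<^sub>F e in sequentially.
      nat \<lceil>t * (real p ^ e - 1)\<rceil> \<le> nat \<lfloor>s * (real p ^ e - 1)\<rfloor>"
  proof (cases "t = 0")
    case False
    then have "t < s" using t by simp
    have "\<forall>\<^sub>F e in sequentially. real p ^ e \<ge> 1 / (s - t) + 1"
      using \<open>p \<ge> 2\<close> by (intro eventually_power_ge) simp
    then show ?thesis
    proof eventually_elim
      case (elim e)
      then have "(s - t) * (real p ^ e - 1) \<ge> 1"
        using \<open>t < s\<close> by (simp add: field_simps)
      then have "t * (real p ^ e - 1) + 1 \<le> s * (real p ^ e - 1)"
        by (simp add: algebra_simps)
      then have "\<lceil>t * (real p ^ e - 1)\<rceil> \<le> \<lfloor>s * (real p ^ e - 1)\<rfloor>"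
        by linarith
      then show ?case
        by (rule nat_mono)
    qed
  qed simp
  \<comment> \<open>The conclusion holds for all large \<open>e\<close>, not only for infinitely many.\<close>
  have "\<forall>\<^sub>F e in sequentially.
      \<exists>f \<in> ideal_power R I (nat \<lceil>t * (real p ^ e - 1)\<rceil>). root_map_splits R p e f"
    using pure[unfolded F_pure_def] le
  proof eventually_elim
    case (elim e)
    then show ?case
      using ideal_power_antimono[OF I elim(2)] by blast
  qed
  then show ?thesis
    unfolding sharply_F_pure_def infinite_nat_iff_unbounded_le eventually_sequentially mem_Collect_eq
    by (meson nat_le_linear order_refl)
qed

lemma (in cring) sharply_F_pure_imp_F_pure:
  assumes I: "ideal I R" and "Factorial_Ring.prime p" and char: "has_char R p"
    and pure: "sharply_F_pure R p I s" and "0 \<le> s" and "0 \<le> t" and t: "t < s \<or> t = 0"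
  shows "F_pure R p I t"
proof -
  have "p \<ge> 2"
    using \<open>Factorial_Ring.prime p\<close> by (rule prime_ge_2_nat)
  have unbounded: "\<exists>e\<ge>m. \<exists>f \<in> ideal_power R I (nat \<lceil>s * (real p ^ e - 1)\<rceil>).
      root_map_splits R p e f" for m
    using pure unfolding sharply_F_pure_def infinite_nat_iff_unbounded_le by blast
  have split_one: "root_map_splits R p r \<one>" for r
  proof -
    obtain e f where "r \<le> e" and f: "f \<in> ideal_power R I (nat \<lceil>s * (real p ^ e - 1)\<rceil>)"
        "root_map_splits R p e f"
      using unbounded by blast
    then show ?thesis
      using root_map_splits_one[OF \<open>Factorial_Ring.prime p\<close> char ideal_power_carrier[OF I f(1)], of "e - r" r]
      by simp
  qed
  obtain d f where "d \<ge> 1" and f: "f \<in> ideal_power R I (nat \<lceil>s * (real p ^ d - 1)\<rceil>)"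
      "root_map_splits R p d f"
    using unbounded by blast
  define N where "N = nat \<lceil>s * (real p ^ d - 1)\<rceil>"
  have N: "real N \<ge> s * (real p ^ d - 1)"
    unfolding N_def by linarith
  define M where "M = (\<lambda>n. \<Sum>i<n. (p ^ d) ^ i)"
  have "\<exists>g \<in> ideal_power R I (nat \<lfloor>t * (real p ^ e - 1)\<rfloor>). root_map_splits R p e g"
    if large: "t = 0 \<or> (s - t) * real p ^ e \<ge> s * real p ^ d" for e
  proof -
    define n r where "n = e div d" and "r = e mod d"
    have e: "e = n * d + r" by (simp add: n_def r_def)
    have "r \<le> d" using \<open>d \<ge> 1\<close> by (simp add: r_def less_imp_le)
    obtain g where g: "g \<in> ideal_power R I (N * M n)" "root_map_splits R p (n * d) g"
      using root_map_splits_iterate[OF I f split_one, of n] by (auto simp: N_def M_def)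
    have gc: "g \<in> carrier R"
      using g ideal_power_carrier[OF I] by blast
    have "nat \<lfloor>t * (real p ^ e - 1)\<rfloor> \<le> N * M n * p ^ r"
    proof (cases "t = 0")
      case False
      have "s * (real p ^ e - real p ^ r) = s * (real p ^ (n * d) - 1) * real p ^ r"
        by (simp add: e power_add algebra_simps)
      also have "real p ^ (n * d) - 1 = (real p ^ d - 1) * real (M n)"
        using power_diff_1_eq[of "real p ^ d" n]
        by (simp add: M_def power_mult [symmetric] mult.commute)
      also have "s * ((real p ^ d - 1) * real (M n)) * real p ^ r
          = (s * (real p ^ d - 1)) * (real (M n) * real p ^ r)"
        by simp
      also have "\<dots> \<le> real N * (real (M n) * real p ^ r)"
        using N by (intro mult_right_mono) auto
      finally have 1: "s * (real p ^ e - real p ^ r) \<le> real (N * M n * p ^ r)"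
        by simp
      have "s * real p ^ r \<le> s * real p ^ d"
        using \<open>r \<le> d\<close> \<open>p \<ge> 2\<close> \<open>0 \<le> s\<close> by (intro mult_left_mono power_increasing) auto
      then have "t * real p ^ e \<le> s * (real p ^ e - real p ^ r)"
        using large False by (simp add: algebra_simps)
      then have "t * (real p ^ e - 1) \<le> real (N * M n * p ^ r)"
        using 1 \<open>0 \<le> t\<close> by (simp add: algebra_simps)
      then show ?thesis
        by linarith
    qed simp
    \<comment> \<open>The splitting for \<open>g\<close> composed with one of \<open>F\<^sup>r\<close> splits the element \<open>g\<^bsup>p^r\<^esup>\<close>.\<close>
    moreover have "g [^] (p ^ r) \<in> ideal_power R I (N * M n * p ^ r)"
      by (intro pow_mem_ideal_power I g)
    ultimately have "g [^] (p ^ r) \<in> ideal_power R I (nat \<lfloor>t * (real p ^ e - 1)\<rfloor>)"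
      using ideal_power_antimono[OF I] by blast
    moreover have "root_map_splits R p e (g [^] (p ^ r))"
      using root_map_splits_comp[OF gc one_closed g(2) split_one, of r] gc by (simp add: e)
    ultimately show ?thesis by blast
  qed
  moreover have "\<forall>\<^sub>F e in sequentially. t = 0 \<or> (s - t) * real p ^ e \<ge> s * real p ^ d"
  proof (cases "t = 0")
    case False
    then have "t < s" using t by simp
    have "\<forall>\<^sub>F e in sequentially. real p ^ e \<ge> s * real p ^ d / (s - t)"
      using \<open>p \<ge> 2\<close> by (intro eventually_power_ge) simp
    then show ?thesis
      using \<open>t < s\<close> by (simp add: field_simps)
  qed simp
  ultimately show ?thesis
    unfolding F_pure_def by (rule eventually_mono [rotated])
qed

text \<open>The alternative \<open>t = 0\<close> is needed for \<open>A = {0}\<close>, where no \<open>t\<close> with \<open>0 \<le> t < s\<close> exists.\<close>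

lemma SUP_ereal_le_of_smaller_mem:
  fixes A B :: "real set"
  assumes "\<And>s. s \<in> A \<Longrightarrow> 0 \<le> s"
    and mem: "\<And>s t. s \<in> A \<Longrightarrow> 0 \<le> t \<Longrightarrow> t < s \<or> t = 0 \<Longrightarrow> t \<in> B"
  shows "(SUP s\<in>A. ereal s) \<le> (SUP s\<in>B. ereal s)"
proof (rule SUP_least)
  fix s assume "s \<in> A"
  then have "0 \<in> B" and "0 \<le> s"
    using assms by auto
  show "ereal s \<le> (SUP s\<in>B. ereal s)"
  proof (rule dense_le)
    fix y assume "y < ereal s"
    then obtain t where t: "y < ereal t" "t < s"
      using ereal_dense2 by fastforce
    have "max t 0 \<in> B"
      using mem[OF \<open>s \<in> A\<close>, of "max t 0"] t by (auto simp: max_def)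
    then have "ereal (max t 0) \<le> (SUP s\<in>B. ereal s)"
      by (rule SUP_upper)
    moreover have "ereal t \<le> ereal (max t 0)"
      by simp
    ultimately show "y \<le> (SUP s\<in>B. ereal s)"
      using t(1) by (meson less_imp_le order_trans)
  qed
qed

theorem proposition5p3:
  fixes R :: "('a, 'm) ring_scheme" and p :: nat and \<aa> :: "'a set"
  assumes "cring R"
    and "noetherian_ring R"
    and "excellent_ring R"
    and "reduced_ring R"
    and "p > 0"
    and "contains_field_of_char R p"
    and "F_finite R p"
    and "ideal \<aa> R"
    and "\<aa> \<inter> not_in_minimal_primes R \<noteq> {}"
  shows "fpt R p \<aa> = (SUP s\<in>{s. 0 \<le> s \<and> sharply_F_pure R p \<aa> s}. ereal s)"
proof -
  interpret cring R by fact
  have "Factorial_Ring.prime p" and "has_char R p"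
    using contains_field_of_charD[OF \<open>contains_field_of_char R p\<close> \<open>p > 0\<close>] by auto
  show ?thesis
    unfolding fpt_def
  proof (intro order_antisym SUP_ereal_le_of_smaller_mem)
    fix s t :: real
    assume "s \<in> {s. 0 \<le> s \<and> F_pure R p \<aa> s}" and "0 \<le> t" and "t < s \<or> t = 0"
    then show "t \<in> {s. 0 \<le> s \<and> sharply_F_pure R p \<aa> s}"
      using F_pure_imp_sharply_F_pure[OF \<open>ideal \<aa> R\<close> prime_ge_2_nat[OF \<open>Factorial_Ring.prime p\<close>]] by blast
  next
    fix s t :: real
    assume "s \<in> {s. 0 \<le> s \<and> sharply_F_pure R p \<aa> s}" and "0 \<le> t" and "t < s \<or> t = 0"
    then show "t \<in> {s. 0 \<le> s \<and> F_pure R p \<aa> s}"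
      using sharply_F_pure_imp_F_pure[OF \<open>ideal \<aa> R\<close> \<open>Factorial_Ring.prime p\<close> \<open>has_char R p\<close>] by blast
  qed auto
qed

end
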